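(* Fix a tree partition of $\omega$, and let $\mathcal C=\{X\subseteq\omega:[T^\infty_X]\text{ is countable}\}$. Then $\mathcal C\subsetneq\mathcal H$, and for every $\alpha<\omega_1$ there is $X\in\mathcal C\setminus\mathcal H_\alpha$, even with $[T^\infty_X]=\varnothing$.
   Context: A tree partition of $\omega$ is a family $\langle A_s:s\in\omega^{<\omega}\rangle$ of infinite subsets of $\omega$ such that $A_\varnothing=\omega$, for each $s$ the family $\{A_{s^\frown n}:n\in\omega\}$ is a partition of $A_s$, and any two distinct points of $\omega$ lie in different cells $A_s\neq A_t$ with $|s|=|t|=n$ for some $n$. For $X\subseteq\omega$ let $T^\infty_X=\{s\in\omega^{<\omega}:X\cap A_s\text{ is infinite}\}$. For a tree $T\subseteq\omega^{<\omega}$, $[T]=\{z\in\omega^\omega:z\upharpoonright n\in T\text{ for all }n\}$. For $T\subseteq\omega^{<\omega}$ put $\mathrm{Succ}_T(s)=\{n:s^\frown n\in T\}$ and $D(T)=\{s\in T:\mathrm{Succ}_T(s)\text{ is infinite}\}$; $D^0(T)=T$, $D^{\alpha+1}(T)=D(D^\alpha(T))$, $D^\lambda(T)=\bigcap_{\beta<\lambda}D^\beta(T)$ for limit $\lambda$. $\mathcal H_\alpha=\{X\subseteq\omega:\varnothing\notin D^\alpha(T^\infty_X)\}$ for $\alpha<\omega_1$, and $\mathcal H=\bigcup_{\alpha<\omega_1}\mathcal H_\alpha$. *)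

theory Defs
  imports
    Complex_Main
    "HOL-Library.Countable_Set_Type"
    "HOL-Library.Disjoint_Sets"
begin

section \<open>The countable ordinals\<close>

text \<open>The well-order \<^term>\<open>cardSuc natLeq\<close> has order type \<open>\<omega>\<^sub>1\<close>, so the elements of
  the following type are the ordinals \<open>\<alpha> < \<omega>\<^sub>1\<close>. The lemmas \<open>countable_lessThan_omega1\<close>
  and \<open>uncountable_omega1\<close> below determine the order type.\<close>

typedef omega1 = "Field (cardSuc natLeq)"
  using Field_cardSuc_not_empty[OF natLeq_Card_order] by blast

instantiation omega1 :: linorder
begin

definition less_eq_omega1 :: "omega1 \<Rightarrow> omega1 \<Rightarrow> bool" where
  "a \<le> b \<longleftrightarrow> (Rep_omega1 a, Rep_omega1 b) \<in> cardSuc natLeq"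

definition less_omega1 :: "omega1 \<Rightarrow> omega1 \<Rightarrow> bool" where
  "a < b \<longleftrightarrow> a \<le> b \<and> a \<noteq> (b :: omega1)"

lemma wo_rel_cardSuc_natLeq: "wo_rel (cardSuc natLeq)"
  using cardSuc_Card_order[OF natLeq_Card_order]
  unfolding wo_rel_def card_order_on_def by blast

instance
proof
  note wo = wo_rel_cardSuc_natLeq
  fix x y z :: omega1
  show antisym: "x \<le> y \<Longrightarrow> y \<le> x \<Longrightarrow> x = y"
    using wo_rel.ANTISYM[OF wo] Rep_omega1_inject
    unfolding less_eq_omega1_def antisym_def by blast
  show "x < y \<longleftrightarrow> x \<le> y \<and> \<not> y \<le> x"
    using wo_rel.ANTISYM[OF wo] wo_rel.REFL[OF wo] Rep_omega1_inject Rep_omega1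
    unfolding less_omega1_def less_eq_omega1_def antisym_def refl_on_def by metis
  show "x \<le> x"
    using wo_rel.REFL[OF wo] Rep_omega1
    unfolding less_eq_omega1_def refl_on_def by blast
  show "x \<le> y \<Longrightarrow> y \<le> z \<Longrightarrow> x \<le> z"
    using wo_rel.TRANS[OF wo]
    unfolding less_eq_omega1_def trans_def by blast
  show "x \<le> y \<or> y \<le> x"
    using wo_rel.TOTALS[OF wo] Rep_omega1
    unfolding less_eq_omega1_def by blast
qed

end

instance omega1 :: wellorder
proof
  fix P :: "omega1 \<Rightarrow> bool" and a :: omega1
  assume step: "\<And>x. (\<And>y. y < x \<Longrightarrow> P y) \<Longrightarrow> P x"
  have wf: "wf (inv_image (cardSuc natLeq - Id) Rep_omega1)"
    using wo_rel.WF[OF wo_rel_cardSuc_natLeq] by (rule wf_inv_image)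
  show "P a"
  proof (induction a rule: wf_induct_rule[OF wf])
    case (1 x)
    show ?case
    proof (rule step)
      fix y assume "y < x"
      then show "P y"
        using 1 by (auto simp: less_omega1_def less_eq_omega1_def Rep_omega1_inject)
    qed
  qed
qed

lemma countable_lessThan_omega1: "countable {..<a :: omega1}"
  including cardinal_syntax
proof -
  have "|underS (cardSuc natLeq) (Rep_omega1 a)| <o cardSuc natLeq"
    by (rule card_of_underS[OF cardSuc_Card_order[OF natLeq_Card_order] Rep_omega1])
  then have "|underS (cardSuc natLeq) (Rep_omega1 a)| \<le>o natLeq"
    using cardSuc_ordLeq_ordLess[OF natLeq_Card_order card_of_Card_order] by blast
  then have c: "countable (underS (cardSuc natLeq) (Rep_omega1 a))"
    by (simp add: countable_card_le_natLeq)
  have "Rep_omega1 ` {..<a} \<subseteq> underS (cardSuc natLeq) (Rep_omega1 a)"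
    by (auto simp: underS_def less_omega1_def less_eq_omega1_def Rep_omega1_inject)
  then have "countable (Rep_omega1 ` {..<a})"
    using c countable_subset by blast
  then show ?thesis
    by (rule countable_image_inj_on) (simp add: inj_on_def Rep_omega1_inject)
qed

lemma uncountable_omega1: "uncountable (UNIV :: omega1 set)"
  including cardinal_syntax
proof
  assume "countable (UNIV :: omega1 set)"
  then have "countable (range Rep_omega1)" by simp
  then have "countable (Field (cardSuc natLeq))"
    using type_definition.Rep_range[OF type_definition_omega1] by simp
  then have "|Field (cardSuc natLeq)| \<le>o natLeq"
    by (simp add: countable_card_le_natLeq)
  then have "cardSuc natLeq \<le>o natLeq"
    using card_of_Field_ordIso[OF cardSuc_Card_order[OF natLeq_Card_order]]
      ordIso_symmetric ordIso_ordLeq_trans by blast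
  then show False
    using cardSuc_greater[OF natLeq_Card_order] not_ordLess_ordLeq by blast
qed

definition ord_zero :: omega1 where
  "ord_zero = (LEAST a. True)"

definition ord_succ :: "omega1 \<Rightarrow> omega1" where
  "ord_succ a = (LEAST b. a < b)"

definition is_limit :: "omega1 \<Rightarrow> bool" where
  "is_limit a \<longleftrightarrow> a \<noteq> ord_zero \<and> (\<nexists>b. a = ord_succ b)"

lemma less_ord_succ: "a < ord_succ a"
proof -
  have "\<exists>b. a < b"
  proof (rule ccontr)
    assume "\<nexists>b. a < b"
    then have "UNIV = insert a {..<a}" by (auto simp: not_less le_less)
    then show False
      using countable_lessThan_omega1[of a] uncountable_omega1 by (metis countable_insert)
  qed
  then show ?thesis unfolding ord_succ_def by (metis LeastI)
qed

lemma ord_succ_le_iff: "ord_succ a \<le> b \<longleftrightarrow> a < b"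
  using less_ord_succ[of a] unfolding ord_succ_def by (meson Least_le less_le_trans)

lemma ord_succ_inject: "ord_succ a = ord_succ b \<longleftrightarrow> a = b"
  by (metis less_ord_succ linorder_less_linear not_less ord_succ_le_iff)

lemma ord_zero_le: "ord_zero \<le> a"
  unfolding ord_zero_def by (simp add: Least_le)

lemma ord_succ_neq_zero: "ord_succ a \<noteq> ord_zero"
  by (metis less_ord_succ not_less ord_zero_le)


section \<open>Tree partitions\<close>

text \<open>Finite sequences \<open>s \<in> \<omega>\<^bsup><\<omega>\<^esup>\<close> are lists, and \<open>s\<close> extended by \<open>n\<close> is \<^term>\<open>s @ [n]\<close>.
  Since all cells are required to be infinite, the parts of the partitions are nonempty.\<close>

definition tree_partition :: "(nat list \<Rightarrow> nat set) \<Rightarrow> bool" where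
  "tree_partition A \<longleftrightarrow>
     (\<forall>s. infinite (A s)) \<and>
     A [] = UNIV \<and>
     (\<forall>s. disjoint_family (\<lambda>n. A (s @ [n])) \<and> (\<Union>n. A (s @ [n])) = A s) \<and>
     (\<forall>x y. x \<noteq> y \<longrightarrow>
        (\<exists>n s t. length s = n \<and> length t = n \<and> x \<in> A s \<and> y \<in> A t \<and> A s \<noteq> A t))"

definition T_inf :: "(nat list \<Rightarrow> nat set) \<Rightarrow> nat set \<Rightarrow> nat list set" where
  "T_inf A X = {s. infinite (X \<inter> A s)}"

text \<open>Here \<^term>\<open>map z [0..<n]\<close> is the restriction of \<open>z\<close> to its first \<open>n\<close> values.\<close>

definition branches :: "nat list set \<Rightarrow> (nat \<Rightarrow> nat) set" where
  "branches T = {z. \<forall>n. map z [0..<n] \<in> T}"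


section \<open>The derivative and its transfinite iterates\<close>

definition Succs :: "nat list set \<Rightarrow> nat list \<Rightarrow> nat set" where
  "Succs T s = {n. s @ [n] \<in> T}"

definition deriv_tree :: "nat list set \<Rightarrow> nat list set" where
  "deriv_tree T = {s \<in> T. infinite (Succs T s)}"

text \<open>The recursion is restated as the usual three clauses in the lemmas that follow it.\<close>

function deriv_iter :: "omega1 \<Rightarrow> nat list set \<Rightarrow> nat list set" where
  "deriv_iter a T =
     (if a = ord_zero then T
      else if \<exists>b. a = ord_succ b then deriv_tree (deriv_iter (THE b. a = ord_succ b) T)
      else (\<Inter>b\<in>{..<a}. deriv_iter b T))"
  by pat_completeness auto
termination
proof (relation "inv_image {(a, b :: omega1). a < b} fst")
  show "wf (inv_image {(a, b :: omega1). a < b} (fst :: omega1 \<times> nat list set \<Rightarrow> omega1))"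
    by (rule wf_inv_image) (rule wf)
qed (auto simp: ord_succ_inject less_ord_succ)

declare deriv_iter.simps [simp del]

lemma deriv_iter_zero: "deriv_iter ord_zero T = T"
  by (subst deriv_iter.simps) simp

lemma deriv_iter_succ: "deriv_iter (ord_succ a) T = deriv_tree (deriv_iter a T)"
  by (subst deriv_iter.simps) (auto simp: ord_succ_inject ord_succ_neq_zero)

lemma deriv_iter_limit: "is_limit a \<Longrightarrow> deriv_iter a T = (\<Inter>b\<in>{..<a}. deriv_iter b T)"
  by (subst deriv_iter.simps) (auto simp: is_limit_def)


section \<open>The families of sets\<close>

definition H_level :: "(nat list \<Rightarrow> nat set) \<Rightarrow> omega1 \<Rightarrow> nat set set" where
  "H_level A a = {X. [] \<notin> deriv_iter a (T_inf A X)}"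

definition H_all :: "(nat list \<Rightarrow> nat set) \<Rightarrow> nat set set" where
  "H_all A = (\<Union>a. H_level A a)"

definition C_branches :: "(nat list \<Rightarrow> nat set) \<Rightarrow> nat set set" where
  "C_branches A = {X. countable (branches (T_inf A X))}"

end

theory Submission
  imports Defs "HOL-Library.Sublist"
begin

text \<open>
  \<^bold>\<open>Reduction to trees.\<close> Every prefix-closed set \<open>T\<close> of finite sequences is of the form \<open>T\<^sup>\<infinity>\<^sub>X\<close>
  (\<open>exists_T_inf_eq\<close>): let \<open>X\<close> consist of one point from every cell that lies immediately below
  some \<open>s \<in> T\<close>. Hence it suffices to find suitable trees, and the sets \<open>X\<close> come for free.

  \<^bold>\<open>Inclusion.\<close> If \<open>\<emptyset>\<close> survives all countable derivatives of \<open>T\<close>, then the intersection \<open>K\<close> of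
  these derivatives contains \<open>\<emptyset>\<close>, and each of its nodes has infinitely many successors in it,
  because countably many countable ordinals have a countable upper bound
  (\<open>infinite_Succs_kernel\<close>). A tree in which all nodes split has uncountably many branches, by
  Cantor's diagonal argument (\<open>uncountable_branches\<close>), and \<open>K \<subseteq> T\<close>.

  \<^bold>\<open>Properness.\<close> The full binary tree has uncountably many branches, but none of its nodes has
  infinitely many successors, so a single derivative makes it empty.

  \<^bold>\<open>Arbitrarily high levels.\<close> Label the natural numbers by countable ordinals in such a way that
  every ordinal below \<open>\<alpha>\<close> is used infinitely often, and let \<open>T\<close> consist of the sequences whose
  labels descend strictly from \<open>\<alpha>\<close>. A branch would be an infinite descending sequence of
  ordinals, so there is none, while a node whose last label is \<open>\<beta>\<close> survives \<open>\<beta>\<close> derivatives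
  (\<open>mem_deriv_iter_descent_tree\<close>). In particular \<open>\<emptyset>\<close> survives \<open>\<alpha>\<close> of them.
\<close>

section \<open>Cells of a tree partition\<close>

lemma cell_mono:
  assumes "tree_partition A" "prefix s t"
  shows "A t \<subseteq> A s"
proof -
  have step: "A (u @ [n]) \<subseteq> A u" for u n
    using assms(1) unfolding tree_partition_def by blast
  obtain u where "t = s @ u" using assms(2) by (auto simp: prefix_def)
  moreover have "A (s @ u) \<subseteq> A s"
  proof (induction u rule: rev_induct)
    case (snoc n u)
    then show ?case using step[of "s @ u" n] by auto
  qed simp
  ultimately show ?thesis by simp
qed

lemma sibling_cells_eq:
  assumes "tree_partition A" "x \<in> A (s @ [m])" "x \<in> A (s @ [n])"
  shows "m = n"
  using assms unfolding tree_partition_def disjoint_family_on_def by blast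

lemma same_level_cells_eq:
  assumes "tree_partition A" "length s = length t" "x \<in> A s" "x \<in> A t"
  shows "s = t"
  using assms(2-4)
proof (induction s arbitrary: t rule: rev_induct)
  case (snoc m s)
  then obtain t' n where t: "t = t' @ [n]" by (metis length_append_singleton length_Suc_conv_rev)
  have "s = t'"
    using snoc t cell_mono[OF assms(1), of s "s @ [m]"] cell_mono[OF assms(1), of t' "t' @ [n]"]
    by auto
  then show ?case using snoc.prems t sibling_cells_eq[OF assms(1)] by blast
qed simp

lemma intersecting_cells_comparable:
  assumes A: "tree_partition A" and "x \<in> A s" "x \<in> A t"
  shows "prefix s t \<or> prefix t s"
proof -
  have *: "prefix u v" if "length u \<le> length v" "x \<in> A u" "x \<in> A v" for u v
  proof -
    have "x \<in> A (take (length u) v)"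
      using that(3) cell_mono[OF A take_is_prefix] by blast
    then have "u = take (length u) v"
      using that same_level_cells_eq[OF A, of u "take (length u) v" x] by simp
    then show ?thesis by (metis take_is_prefix)
  qed
  then show ?thesis using assms(2,3) by (meson nat_le_linear)
qed

text \<open>The set \<open>X\<close> takes one point from each cell immediately below a node of \<open>T\<close>. For \<open>s \<in> T\<close>,
  the chosen points immediately below \<open>s\<close> are already infinitely many points of \<open>A s\<close>. For
  \<open>s \<notin> T\<close>, no chosen cell lies strictly inside \<open>A s\<close>, so points of \<open>X\<close> in \<open>A s\<close> come
  only from the finitely many chosen cells that include \<open>A s\<close>.\<close>

lemma exists_T_inf_eq:
  assumes A: "tree_partition A"
    and closed: "\<And>s t. t \<in> T \<Longrightarrow> prefix s t \<Longrightarrow> s \<in> T"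
  obtains X where "T_inf A X = T"
proof -
  have "\<forall>t. \<exists>x. x \<in> A t"
    using A unfolding tree_partition_def by (metis finite.emptyI ex_in_conv)
  then obtain p where p: "\<And>t. p t \<in> A t" by metis
  define X where "X = {p (s @ [n]) | s n. s \<in> T}"
  have "infinite (X \<inter> A s)" if "s \<in> T" for s
  proof -
    have "inj (\<lambda>n. p (s @ [n]))"
      by (rule injI) (metis p sibling_cells_eq[OF A])
    then have "infinite (range (\<lambda>n. p (s @ [n])))" by (rule range_inj_infinite)
    moreover have "p (s @ [n]) \<in> X \<inter> A s" for n
      using that p[of "s @ [n]"] cell_mono[OF A, of s "s @ [n]"] unfolding X_def by auto
    then have "range (\<lambda>n. p (s @ [n])) \<subseteq> X \<inter> A s" by blast
    ultimately show ?thesis by (rule infinite_super[rotated])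
  qed
  moreover have "finite (X \<inter> A s)" if "s \<notin> T" for s
  proof -
    have "X \<inter> A s \<subseteq> p ` set (prefixes s)"
    proof
      fix x assume x: "x \<in> X \<inter> A s"
      then obtain t n where t: "t \<in> T" "x = p (t @ [n])" unfolding X_def by blast
      then have "prefix s (t @ [n]) \<or> prefix (t @ [n]) s"
        using x p intersecting_cells_comparable[OF A] by blast
      moreover have "\<not> prefix s t" using closed t that by blast
      ultimately have "prefix (t @ [n]) s" by (auto simp: prefix_snoc)
      then show "x \<in> p ` set (prefixes s)" using t by simp
    qed
    then show ?thesis by (rule finite_subset) simp
  qed
  ultimately have "T_inf A X = T" unfolding T_inf_def by blast
  then show thesis by (rule that)
qed

section \<open>Branches\<close>

lemma branches_mono: "S \<subseteq> T \<Longrightarrow> branches S \<subseteq> branches T"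
  unfolding branches_def by blast

text \<open>The splitting condition says that a node always has a successor other than a prescribed one;
  this is what the diagonal argument needs in order to leave the \<open>n\<close>-th branch of a list
  at the \<open>n\<close>-th step.\<close>

lemma uncountable_branches:
  assumes root: "[] \<in> K"
    and split: "\<And>s m. s \<in> K \<Longrightarrow> \<exists>k. k \<noteq> m \<and> s @ [k] \<in> K"
  shows "uncountable (branches K)"
proof
  assume c: "countable (branches K)"
  define b where "b = from_nat_into (branches K)"
  have "\<exists>S. \<forall>n. (S n \<in> K \<and> length (S n) = n) \<and> (\<exists>k. k \<noteq> b n n \<and> S (Suc n) = S n @ [k])"
  proof (rule dependent_nat_choice)
    show "\<exists>s. s \<in> K \<and> length s = 0" using root by blast
  next
    fix s n assume "s \<in> K \<and> length s = n"
    then show "\<exists>s'. (s' \<in> K \<and> length s' = Suc n) \<and> (\<exists>k. k \<noteq> b n n \<and> s' = s @ [k])"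
      using split[of s "b n n"] by auto
  qed
  then obtain S where S: "\<And>n. S n \<in> K" "\<And>n. length (S n) = n"
      "\<And>n. \<exists>k. k \<noteq> b n n \<and> S (Suc n) = S n @ [k]"
    by blast
  then obtain z where z: "\<And>n. z n \<noteq> b n n" "\<And>n. S (Suc n) = S n @ [z n]" by metis
  have "map z [0..<n] = S n" for n
    using S(2)[of 0] by (induction n) (simp_all add: z(2))
  then have "z \<in> branches K" unfolding branches_def using S(1) by simp
  then obtain n where "b n = z"
    unfolding b_def using from_nat_into_surj[OF c] by blast
  then show False using z(1)[of n] by simp
qed

section \<open>Countable ordinals and iterated derivatives\<close>

lemma omega1_cases:
  obtains "a = ord_zero" | b where "a = ord_succ b" | "is_limit a"
  unfolding is_limit_def by blast

lemma countable_bounded_omega1: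
  fixes f :: "nat \<Rightarrow> omega1"
  obtains b where "\<And>n. f n < b"
proof -
  have "countable (\<Union>n. {..f n})"
    using countable_lessThan_omega1 by (auto simp flip: ivl_disj_un(2))
  then have "(\<Union>n. {..f n}) \<noteq> UNIV" using uncountable_omega1 by metis
  then obtain b where "b \<notin> (\<Union>n. {..f n})" by blast
  then show thesis using that[of b] by (simp add: not_le)
qed

lemma deriv_iter_antimono:
  assumes "a \<le> b"
  shows "deriv_iter b T \<subseteq> deriv_iter a T"
  using assms
proof (induction b rule: less_induct)
  case (less b)
  show ?case
  proof (cases "a = b")
    case False
    with less.prems have "a < b" by simp
    show ?thesis
    proof (cases b rule: omega1_cases)
      case 1
      with \<open>a < b\<close> show ?thesis using ord_zero_le[of a] by simp
    next
      case (2 c)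
      with \<open>a < b\<close> have "a \<le> c" by (metis not_le ord_succ_le_iff)
      then have "deriv_iter c T \<subseteq> deriv_iter a T"
        using less.IH 2 less_ord_succ by blast
      then show ?thesis using 2 by (auto simp: deriv_iter_succ deriv_tree_def)
    next
      case 3
      with \<open>a < b\<close> show ?thesis by (auto simp: deriv_iter_limit)
    qed
  qed simp
qed

text \<open>Each successor of \<open>s\<close> outside the intersection is removed at some countable stage, and one
  countable stage \<open>b\<close> bounds all of them. As \<open>s\<close> still belongs to the derivative at \<open>b + 1\<close>, it has
  infinitely many successors at stage \<open>b\<close>, and these are never removed.\<close>

lemma infinite_Succs_kernel:
  assumes "s \<in> (\<Inter>a. deriv_iter a T)"
  shows "infinite (Succs (\<Inter>a. deriv_iter a T) s)"
proof -
  have "\<forall>n. \<exists>a. s @ [n] \<notin> (\<Inter>a. deriv_iter a T) \<longrightarrow> s @ [n] \<notin> deriv_iter a T"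
    by blast
  then obtain f where f:
      "\<And>n. s @ [n] \<notin> (\<Inter>a. deriv_iter a T) \<Longrightarrow> s @ [n] \<notin> deriv_iter (f n) T"
    by metis
  obtain b where b: "\<And>n. f n < b" using countable_bounded_omega1[of f] by blast
  have "deriv_iter b T \<subseteq> deriv_iter (f n) T" for n
    using deriv_iter_antimono[of "f n" b] b[of n] by simp
  then have "Succs (deriv_iter b T) s \<subseteq> Succs (\<Inter>a. deriv_iter a T) s"
    unfolding Succs_def using f by blast
  moreover have "s \<in> deriv_iter (ord_succ b) T" using assms by blast
  then have "infinite (Succs (deriv_iter b T) s)"
    by (simp add: deriv_iter_succ deriv_tree_def)
  ultimately show ?thesis by (rule infinite_super)
qed

lemma C_branches_subset_H_all: "C_branches A \<subseteq> H_all A"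
proof
  fix X assume X: "X \<in> C_branches A"
  let ?T = "T_inf A X"
  let ?K = "\<Inter>a. deriv_iter a ?T"
  show "X \<in> H_all A"
  proof (rule ccontr)
    assume "X \<notin> H_all A"
    then have "[] \<in> ?K" by (simp add: H_all_def H_level_def)
    moreover have "\<exists>k. k \<noteq> m \<and> s @ [k] \<in> ?K" if "s \<in> ?K" for s m
    proof -
      have "infinite (Succs ?K s - {m})"
        using infinite_Succs_kernel[OF that] by (rule infinite_remove)
      then obtain k where "k \<in> Succs ?K s - {m}" using infinite_imp_nonempty by blast
      then have "k \<noteq> m \<and> s @ [k] \<in> ?K" by (simp add: Succs_def)
      then show ?thesis ..
    qed
    ultimately have "uncountable (branches ?K)" by (rule uncountable_branches)
    moreover have "?K \<subseteq> ?T" using deriv_iter_zero by blast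
    then have "branches ?K \<subseteq> branches ?T" by (rule branches_mono)
    moreover have "countable (branches ?T)" using X by (simp add: C_branches_def)
    ultimately show False by (metis countable_subset)
  qed
qed

section \<open>The binary tree\<close>

lemma H_all_not_subset_C_branches:
  assumes "tree_partition A"
  shows "\<not> H_all A \<subseteq> C_branches A"
proof -
  define T :: "nat list set" where "T = {s. set s \<subseteq> {0, 1}}"
  have "s \<in> T" if "t \<in> T" "prefix s t" for s t
    using that set_mono_prefix[of s t] unfolding T_def by blast
  then obtain X where X: "T_inf A X = T" by (rule exists_T_inf_eq[OF assms])
  have "finite (Succs T s)" for s
    by (rule finite_subset[of _ "{0, 1}"]) (auto simp: Succs_def T_def)
  then have "deriv_tree T = {}" by (simp add: deriv_tree_def)
  then have "[] \<notin> deriv_iter (ord_succ ord_zero) T"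
    by (simp add: deriv_iter_succ deriv_iter_zero)
  then have "X \<in> H_all A" using X by (auto simp: H_all_def H_level_def)
  moreover have "uncountable (branches T)"
  proof (rule uncountable_branches)
    show "\<exists>k. k \<noteq> m \<and> s @ [k] \<in> T" if "s \<in> T" for s m
      using that unfolding T_def by (intro exI[of _ "if m = 0 then 1 else 0"]) auto
  qed (simp add: T_def)
  then have "X \<notin> C_branches A" using X by (simp add: C_branches_def)
  ultimately show ?thesis by blast
qed

section \<open>Trees of descending sequences of ordinals\<close>

definition descent_tree :: "(nat \<Rightarrow> omega1) \<Rightarrow> omega1 \<Rightarrow> nat list set" where
  "descent_tree g a = {s. sorted_wrt (>) (a # map g s)}"

lemma descent_tree_prefix_closed:
  "t \<in> descent_tree g a \<Longrightarrow> prefix s t \<Longrightarrow> s \<in> descent_tree g a"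
  by (auto simp: descent_tree_def prefix_def sorted_wrt_append)

lemma descent_tree_snoc:
  assumes "s \<in> descent_tree g a" "g n < last (a # map g s)"
  shows "s @ [n] \<in> descent_tree g a"
proof -
  let ?l = "a # map g s"
  have l: "?l = butlast ?l @ [last ?l]" by (rule append_butlast_last_id[symmetric]) simp
  have "sorted_wrt (>) (butlast ?l @ [last ?l])"
    using assms(1) l unfolding descent_tree_def by (metis mem_Collect_eq)
  then have "\<forall>c \<in> set (butlast ?l). last ?l < c" by (simp only: sorted_wrt_append) simp
  moreover have "set ?l = insert (last ?l) (set (butlast ?l))"
    by (subst l) (simp only: set_append list.set Un_insert_right Un_empty_right)
  ultimately have "\<forall>c \<in> set ?l. g n < c" using assms(2) by (metis insertE less_trans)
  then show ?thesis using assms(1) by (auto simp: descent_tree_def sorted_wrt_append)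
qed

lemma branches_descent_tree: "branches (descent_tree g a) = {}"
proof -
  have "False" if z: "z \<in> branches (descent_tree g a)" for z
  proof -
    have "g (z (Suc n)) < g (z n)" for n
    proof -
      have "map z [0..<Suc (Suc n)] \<in> descent_tree g a"
        using z unfolding branches_def by blast
      then show ?thesis by (simp add: descent_tree_def sorted_wrt_append)
    qed
    then show False
      using wf_no_infinite_down_chainE[OF wf, of "\<lambda>n. g (z n)"] by blast
  qed
  then show ?thesis by blast
qed

text \<open>The rank of a node is at least its last label, which for the empty sequence is \<open>a\<close> itself. A
  node with last label above \<open>c\<close> has infinitely many successors labelled \<open>c\<close>, and
  inductively these survive \<open>c\<close> derivatives, so the node survives one more.\<close>

lemma mem_deriv_iter_descent_tree:
  assumes label: "\<And>c. c < a \<Longrightarrow> infinite {n. g n = c}"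
    and "s \<in> descent_tree g a" "b \<le> last (a # map g s)"
  shows "s \<in> deriv_iter b (descent_tree g a)"
  using assms(2,3)
proof (induction b arbitrary: s rule: less_induct)
  case (less b)
  show ?case
  proof (cases b rule: omega1_cases)
    case 1
    then show ?thesis using less.prems by (simp add: deriv_iter_zero)
  next
    case (2 c)
    then have c: "c < b" "c < last (a # map g s)"
      using less.prems less_ord_succ ord_succ_le_iff by auto
    have "last (a # map g s) \<le> a"
      using less.prems(1) by (auto simp: descent_tree_def last_map intro!: less_imp_le)
    with c have "infinite {n. g n = c}" using label by simp
    moreover have "{n. g n = c} \<subseteq> Succs (deriv_iter c (descent_tree g a)) s"
    proof (clarsimp simp: Succs_def)
      fix n assume "c = g n"
      then show "s @ [n] \<in> deriv_iter (g n) (descent_tree g a)"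
        using less.IH[OF c(1), of "s @ [n]"] less.prems(1) c(2) by (simp add: descent_tree_snoc)
    qed
    ultimately have "infinite (Succs (deriv_iter c (descent_tree g a)) s)"
      by (rule infinite_super[rotated])
    moreover have "s \<in> deriv_iter c (descent_tree g a)"
      using less.IH[OF c(1)] less.prems(1) c(2) by simp
    ultimately show ?thesis using 2 by (simp add: deriv_iter_succ deriv_tree_def)
  next
    case 3
    then show ?thesis using less by (auto simp: deriv_iter_limit)
  qed
qed

lemma exists_infinitely_repeating_labelling:
  fixes a :: omega1
  obtains g :: "nat \<Rightarrow> omega1" where "\<And>c. c < a \<Longrightarrow> infinite {n. g n = c}"
proof -
  define g where "g n = from_nat_into {..<a} (fst (prod_decode n))" for n
  have "infinite {n. g n = c}" if "c < a" for c
  proof -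
    obtain i where i: "from_nat_into {..<a} i = c"
      using from_nat_into_surj[OF countable_lessThan_omega1] \<open>c < a\<close> by blast
    have "inj (\<lambda>j. prod_encode (i, j))" by (simp add: inj_def)
    then have "infinite (range (\<lambda>j. prod_encode (i, j)))" by (rule range_inj_infinite)
    moreover have "range (\<lambda>j. prod_encode (i, j)) \<subseteq> {n. g n = c}"
      using i by (auto simp: g_def)
    ultimately show ?thesis by (rule infinite_super[rotated])
  qed
  then show thesis by (rule that)
qed

lemma exists_branchless_not_in_H_level:
  assumes "tree_partition A"
  obtains X where "branches (T_inf A X) = {}" "X \<notin> H_level A a"
proof -
  obtain g :: "nat \<Rightarrow> omega1" where g: "\<And>c. c < a \<Longrightarrow> infinite {n. g n = c}"
    using exists_infinitely_repeating_labelling[of a] by blast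
  obtain X where X: "T_inf A X = descent_tree g a"
    by (rule exists_T_inf_eq[OF assms]) (rule descent_tree_prefix_closed)
  have "[] \<in> deriv_iter a (descent_tree g a)"
    using mem_deriv_iter_descent_tree[OF g, of a "[]" a] by (simp add: descent_tree_def)
  then show thesis
    using that[of X] X branches_descent_tree by (simp add: H_level_def)
qed

section \<open>The comparison of the two families\<close>

theorem theorem7p3:
  fixes A :: "nat list \<Rightarrow> nat set"
  assumes "tree_partition A"
  shows "C_branches A \<subset> H_all A \<and>
    (\<forall>\<alpha> :: omega1. \<exists>X. X \<in> C_branches A - H_level A \<alpha> \<and> branches (T_inf A X) = {})"
proof (intro conjI allI)
  show "C_branches A \<subset> H_all A"
    using C_branches_subset_H_all H_all_not_subset_C_branches[OF assms] by blast
next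
  fix \<alpha> :: omega1
  obtain X where X: "branches (T_inf A X) = {}" "X \<notin> H_level A \<alpha>"
    by (rule exists_branchless_not_in_H_level[OF assms])
  have "X \<in> C_branches A" using X(1) by (simp add: C_branches_def)
  with X show "\<exists>X. X \<in> C_branches A - H_level A \<alpha> \<and> branches (T_inf A X) = {}"
    by blast
qed

end
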